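(* Let $\gamma$ be a real constant, and let $(A_1^{(k)})_k$ be a family of adjacency matrices of finite undirected graphs, $A_1^{(k)}$ having $n_k$ vertices, whose continuous-time quantum walks can be efficiently implemented. For each $k$, consider the interdependent network consisting of two disjoint copies of the graph $A_1^{(k)}$ with identity interconnections, i.e. the graph on $2n_k$ vertices with adjacency matrix $$\begin{pmatrix} A_1^{(k)} & I_{n_k}\\ I_{n_k} & A_1^{(k)}\end{pmatrix},$$ where $I_{n}$ is the $n\times n$ identity matrix. Then the continuous-time quantum walks on this family of interdependent networks can be efficiently implemented.
   Context: The adjacency matrix $A$ of an undirected graph on vertices $v_1,\dots,v_n$ is the symmetric $n\times n$ matrix with $A_{jk}=1$ if $(v_j,v_k)$ is an edge and $0$ otherwise. The continuous-time quantum walk (CTQW) on a graph with adjacency matrix $A$ is the evolution $U(t)=\exp(-itH)$, $t\ge0$, on the Hilbert space $\mathbb{C}^n$ with orthonormal basis indexed by the vertices, where $H=\gamma A$ and $\gamma$ is a fixed real constant (the hopping rate). Efficient implementation: an encoding of $n$ vertices is an injective map from the vertices to the computational basis states of a $q$-qubit register (with $q=m$ if $n=2^m$); it identifies $\mathbb{C}^n$ with a subspace of the register space. A quantum circuit (possibly using additional ancilla qubits that start in and are returned to $|0\rangle$) implements a unitary on $\mathbb{C}^n$ if it acts exactly (error $\epsilon=0$) as that unitary on the encoded subspace. The CTQWs of a family of graphs with adjacency matrices $(A^{(k)})_k$ of sizes $n_k$ can be efficiently implemented if there are encodings and a polynomial $p$ such that for every $k$ and every $t\ge0$ the operator $\exp(-it\gamma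 A^{(k)})$ is implemented by a quantum circuit with at most $p(\log n_k)$ one- and two-qubit gates (arbitrary unitary gates, whose parameters may depend on $t$, while the encoding does not); in particular the bound on the number of gates does not depend on $t$. *)

theory Defs
  imports
    Complex_Main
    "HOL-Computational_Algebra.Polynomial"
    "Jordan_Normal_Form.Schur_Decomposition"
begin

text \<open>
  Vertices are numbered from 0.  Self-loops are not excluded, so simple graphs are a special case.
\<close>

definition undirected_graph :: "nat \<Rightarrow> (nat \<times> nat) set \<Rightarrow> bool" where
  "undirected_graph n E \<longleftrightarrow> E \<subseteq> {..<n} \<times> {..<n} \<and> sym E"

definition adjacency_mat :: "nat \<Rightarrow> (nat \<times> nat) set \<Rightarrow> complex mat" where
  "adjacency_mat n E = mat n n (\<lambda>(j, k). if (j, k) \<in> E then 1 else 0)"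

text \<open>
  The exponential series, summed entrywise; \<open>summable_mat_exp\<close> below shows that it converges
  for every square matrix.
\<close>

definition mat_exp :: "complex mat \<Rightarrow> complex mat" where
  "mat_exp A = mat (dim_row A) (dim_row A) (\<lambda>(i, j). \<Sum>m. (A ^\<^sub>m m) $$ (i, j) / fact m)"

definition ctqw :: "real \<Rightarrow> complex mat \<Rightarrow> real \<Rightarrow> complex mat" where
  "ctqw \<gamma> A t = mat_exp ((- \<i> * of_real t) \<cdot>\<^sub>m (of_real \<gamma> \<cdot>\<^sub>m A))"

definition unitary_mat :: "nat \<Rightarrow> complex mat \<Rightarrow> bool" where
  "unitary_mat d U \<longleftrightarrow>
     U \<in> carrier_mat d d \<and> mat_adjoint U * U = 1\<^sub>m d \<and> U * mat_adjoint U = 1\<^sub>m d"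

text \<open>
  The computational basis states of \<open>N\<close> qubits are numbered by \<open>x < 2 ^ N\<close>, qubit \<open>i\<close> being in
  state \<open>bit x i\<close>.  A gate \<open>(qs, U)\<close> applies \<open>U\<close> to the qubits listed in \<open>qs\<close>, the \<open>l\<close>-th listed
  qubit supplying bit \<open>l\<close> of the row and column numbers of \<open>U\<close>.
\<close>

type_synonym gate = "nat list \<times> complex mat"

definition valid_gate :: "nat \<Rightarrow> gate \<Rightarrow> bool" where
  "valid_gate N = (\<lambda>(qs, U).
     length qs \<in> {1, 2} \<and> distinct qs \<and> set qs \<subseteq> {..<N} \<and> unitary_mat (2 ^ length qs) U)"

definition sub_index :: "nat list \<Rightarrow> nat \<Rightarrow> nat" where
  "sub_index qs x = (\<Sum>l<length qs. of_bool (bit x (qs ! l)) * 2 ^ l)"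

definition gate_mat :: "nat \<Rightarrow> gate \<Rightarrow> complex mat" where
  "gate_mat N = (\<lambda>(qs, U). mat (2 ^ N) (2 ^ N) (\<lambda>(x, y).
     if \<forall>i<N. i \<notin> set qs \<longrightarrow> bit x i = bit y i
     then U $$ (sub_index qs x, sub_index qs y) else 0))"

text \<open>The head of the list is the gate that is applied first.\<close>

fun circuit_mat :: "nat \<Rightarrow> gate list \<Rightarrow> complex mat" where
  "circuit_mat N [] = 1\<^sub>m (2 ^ N)"
| "circuit_mat N (g # gs) = circuit_mat N gs * gate_mat N g"

definition is_encoding :: "nat \<Rightarrow> nat \<Rightarrow> (nat \<Rightarrow> nat) \<Rightarrow> bool" where
  "is_encoding n q f \<longleftrightarrow>
     inj_on f {..<n} \<and> f ` {..<n} \<subseteq> {..<2 ^ q} \<and> (\<forall>m. n = 2 ^ m \<longrightarrow> q = m)"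

text \<open>
  The state \<open>\<Sum>\<^sub>j \<psi>\<^sub>j |f j\<rangle> \<otimes> |0\<dots>0\<rangle>\<close> of \<open>N\<close> qubits: if \<open>f j < 2 ^ q\<close> for all \<open>j\<close>, then the qubits
  \<open>q, \<dots>, N - 1\<close> are all in state 0.
\<close>

definition encode :: "nat \<Rightarrow> (nat \<Rightarrow> nat) \<Rightarrow> complex vec \<Rightarrow> complex vec" where
  "encode N f \<psi> = vec (2 ^ N) (\<lambda>x. \<Sum>j<dim_vec \<psi>. if f j = x then \<psi> $ j else 0)"

text \<open>Qubits \<open>0, \<dots>, q - 1\<close> form the register; qubits \<open>q, \<dots>, q + a - 1\<close> are the ancillas.\<close>

definition implements ::
  "nat \<Rightarrow> nat \<Rightarrow> gate list \<Rightarrow> (nat \<Rightarrow> nat) \<Rightarrow> nat \<Rightarrow> complex mat \<Rightarrow> bool" where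
  "implements q a gs f n U \<longleftrightarrow>
     (\<forall>g \<in> set gs. valid_gate (q + a) g) \<and>
     (\<forall>\<psi> \<in> carrier_vec n.
        circuit_mat (q + a) gs *\<^sub>v encode (q + a) f \<psi> = encode (q + a) f (U *\<^sub>v \<psi>))"

definition ctqw_efficiently_implementable :: "real \<Rightarrow> ('k \<Rightarrow> complex mat) \<Rightarrow> bool" where
  "ctqw_efficiently_implementable \<gamma> A \<longleftrightarrow>
     (\<exists>(q :: 'k \<Rightarrow> nat) (enc :: 'k \<Rightarrow> nat \<Rightarrow> nat) (p :: real poly).
        \<forall>k. is_encoding (dim_row (A k)) (q k) (enc k) \<and>
          (\<forall>t\<ge>0. \<exists>a gs.
             implements (q k) a gs (enc k) (dim_row (A k)) (ctqw \<gamma> (A k) t) \<and>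
             real (length gs) \<le> poly p (log 2 (real (dim_row (A k))))))"

lemma summable_mat_exp:
  fixes A :: "complex mat"
  assumes A: "A \<in> carrier_mat n n" and ij: "i < n" "j < n"
  shows "summable (\<lambda>m. (A ^\<^sub>m m) $$ (i, j) / fact m)"
proof -
  define s where "s = 1 + (\<Sum>k<n. \<Sum>l<n. norm (A $$ (k, l)))"
  have s1: "1 \<le> s" unfolding s_def by (simp add: sum_nonneg)
  have col: "(\<Sum>k<n. norm (A $$ (k, l))) \<le> s" if "l < n" for l
  proof -
    have "norm (A $$ (k, l)) \<le> (\<Sum>l<n. norm (A $$ (k, l)))" for k
      by (rule member_le_sum) (use that in auto)
    then show ?thesis
      using sum_mono[of "{..<n}" "\<lambda>k. norm (A $$ (k, l))" "\<lambda>k. \<Sum>l<n. norm (A $$ (k, l))"]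
      unfolding s_def by force
  qed
  have bound: "norm ((A ^\<^sub>m m) $$ (i, l)) \<le> s ^ m" if "l < n" for l m
    using that
  proof (induction m arbitrary: l)
    case 0
    then show ?case using A ij by simp
  next
    case (Suc m)
    have Am: "A ^\<^sub>m m \<in> carrier_mat n n" using A by simp
    have "(A ^\<^sub>m Suc m) $$ (i, l) = (\<Sum>k<n. (A ^\<^sub>m m) $$ (i, k) * A $$ (k, l))"
      using A Am Suc.prems ij
      by (simp add: scalar_prod_def atLeast0LessThan)
    also have "norm \<dots> \<le> (\<Sum>k<n. s ^ m * norm (A $$ (k, l)))"
      by (intro sum_norm_le) (simp add: norm_mult mult_right_mono Suc.IH)
    also have "\<dots> \<le> s ^ m * s"
      unfolding sum_distrib_left[symmetric] using col[OF Suc.prems] s1 by (intro mult_left_mono) auto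
    finally show ?case by (simp add: mult.commute)
  qed
  show ?thesis
  proof (rule summable_comparison_test')
    show "summable (\<lambda>m. s ^ m / fact m)"
      using summable_exp[of s] by (simp add: field_simps)
    show "norm ((A ^\<^sub>m m) $$ (i, j) / fact m) \<le> s ^ m / fact m" if "0 \<le> m" for m
      using bound[OF ij(2), of m] by (simp add: norm_divide divide_right_mono)
  qed
qed

end

(*
  Write X for the Pauli matrix. The Hamiltonian of the doubled graph is A \<otimes> 1 + 1 \<otimes> X up to the
  order of the tensor factors, and the two summands commute, so its evolution is the evolution of A
  on the old register together with the one-qubit gate exp(- i t \<gamma> X), whose entries are cosh c and
  sinh c for c = - i t \<gamma>. The vertices j and n + j are encoded by f j with the new qubit in state 0
  and 1. The new qubit takes position q, so the ancillas of the old circuit move up by one.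
*)
theory Submission
  imports Defs
begin

subsection \<open>The exponential of the doubled matrix\<close>

lemma pow_mat_Suc_index:
  fixes M :: "complex mat"
  assumes "M \<in> carrier_mat n n" "i < n" "j < n"
  shows "(M ^\<^sub>m Suc m) $$ (i, j) = (\<Sum>k<n. (M ^\<^sub>m m) $$ (i, k) * M $$ (k, j))"
  using assms by (simp add: scalar_prod_def atLeast0LessThan)

lemma pow_smult_mat_index:
  fixes M :: "complex mat"
  assumes M: "M \<in> carrier_mat n n" and "i < n" "j < n"
  shows "((z \<cdot>\<^sub>m M) ^\<^sub>m m) $$ (i, j) = z ^ m * (M ^\<^sub>m m) $$ (i, j)"
  using assms(2,3)
proof (induction m arbitrary: j)
  case 0
  then show ?case using M by simp
next
  case (Suc m)
  have "((z \<cdot>\<^sub>m M) ^\<^sub>m Suc m) $$ (i, j) = (\<Sum>k<n. ((z \<cdot>\<^sub>m M) ^\<^sub>m m) $$ (i, k) * (z \<cdot>\<^sub>m M) $$ (k, j))"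
    using M Suc.prems by (intro pow_mat_Suc_index) auto
  also have "\<dots> = (\<Sum>k<n. z ^ Suc m * ((M ^\<^sub>m m) $$ (i, k) * M $$ (k, j)))"
    using M Suc by (intro sum.cong) auto
  also have "\<dots> = z ^ Suc m * (M ^\<^sub>m Suc m) $$ (i, j)"
    unfolding pow_mat_Suc_index[OF M Suc.prems] sum_distrib_left ..
  finally show ?case .
qed

text \<open>
  Summability of the exponential series of \<open>2 \<cdot>\<^sub>m M\<close> places 1 strictly inside the disc of
  convergence of the power series with coefficients \<open>(M ^\<^sub>m m) $$ (i, j) / fact m\<close>.
\<close>

lemma summable_norm_mat_exp:
  fixes M :: "complex mat"
  assumes M: "M \<in> carrier_mat n n" and "i < n" "j < n"
  shows "summable (\<lambda>m. norm ((M ^\<^sub>m m) $$ (i, j) / fact m))"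
proof -
  have "summable (\<lambda>m. ((2 \<cdot>\<^sub>m M) ^\<^sub>m m) $$ (i, j) / fact m)"
    using assms by (intro summable_mat_exp[of _ n]) auto
  then have "summable (\<lambda>m. ((M ^\<^sub>m m) $$ (i, j) / fact m) * 2 ^ m)"
    using assms by (simp add: pow_smult_mat_index mult.commute)
  from powser_insidea[OF this, of 1] show ?thesis by simp
qed

text \<open>Pascal's rule under the summation sign; this is the inductive step of the binomial
  theorem below.\<close>

lemma sum_binomial_Suc:
  fixes g :: "nat \<Rightarrow> 'a :: comm_semiring_1"
  shows "(\<Sum>k\<le>Suc m. of_nat (Suc m choose k) * g k)
       = (\<Sum>k\<le>m. of_nat (m choose k) * (g k + g (Suc k)))"
proof -
  have "(\<Sum>k\<le>Suc m. of_nat (Suc m choose k) * g k)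
      = g 0 + (\<Sum>k\<le>m. of_nat (Suc m choose Suc k) * g (Suc k))"
    unfolding sum.atMost_Suc_shift by simp
  also have "\<dots> = (g 0 + (\<Sum>k\<le>m. of_nat (m choose Suc k) * g (Suc k)))
      + (\<Sum>k\<le>m. of_nat (m choose k) * g (Suc k))"
    by (simp add: sum.distrib algebra_simps)
  also have "g 0 + (\<Sum>k\<le>m. of_nat (m choose Suc k) * g (Suc k))
      = (\<Sum>k\<le>Suc m. of_nat (m choose k) * g k)"
    unfolding sum.atMost_Suc_shift by simp
  also have "\<dots> = (\<Sum>k\<le>m. of_nat (m choose k) * g k)"
    by (simp add: binomial_eq_0)
  finally show ?thesis by (simp add: sum.distrib algebra_simps)
qed

text \<open>The binomial theorem holds here because a scalar matrix commutes with \<open>M\<close>.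
  It is stated entrywise so that it can be compared with a Cauchy product of complex series.\<close>

lemma pow_add_scalar_mat_index:
  fixes M :: "complex mat"
  assumes M: "M \<in> carrier_mat n n" and "i < n" "j < n"
  shows "((M + c \<cdot>\<^sub>m 1\<^sub>m n) ^\<^sub>m m) $$ (i, j)
       = (\<Sum>k\<le>m. of_nat (m choose k) * (c ^ (m - k) * (M ^\<^sub>m k) $$ (i, j)))"
  using assms(2,3)
proof (induction m arbitrary: j)
  case 0
  then show ?case using M by simp
next
  case (Suc m)
  let ?T = "\<lambda>l. ((M + c \<cdot>\<^sub>m 1\<^sub>m n) ^\<^sub>m m) $$ (i, l)"
  have "((M + c \<cdot>\<^sub>m 1\<^sub>m n) ^\<^sub>m Suc m) $$ (i, j)
      = (\<Sum>l<n. ?T l * (M + c \<cdot>\<^sub>m 1\<^sub>m n) $$ (l, j))"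
    using M Suc.prems by (intro pow_mat_Suc_index) auto
  also have "\<dots> = (\<Sum>l<n. ?T l * M $$ (l, j) + (if l = j then c * ?T l else 0))"
    using M Suc.prems by (intro sum.cong) (auto simp: algebra_simps)
  also have "\<dots> = (\<Sum>l<n. ?T l * M $$ (l, j)) + c * ?T j"
    using Suc.prems by (simp add: sum.distrib)
  also have "(\<Sum>l<n. ?T l * M $$ (l, j))
      = (\<Sum>l<n. \<Sum>k\<le>m. of_nat (m choose k) * (c ^ (m - k) * ((M ^\<^sub>m k) $$ (i, l) * M $$ (l, j))))"
    using Suc by (intro sum.cong) (auto simp: sum_distrib_right mult.assoc)
  also have "\<dots> = (\<Sum>k\<le>m. of_nat (m choose k) * (c ^ (m - k) * (M ^\<^sub>m Suc k) $$ (i, j)))"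
    unfolding pow_mat_Suc_index[OF M Suc.prems] sum_distrib_left by (rule sum.swap)
  \<comment> \<open>With \<open>g k = c ^ (Suc m - k) * (M ^\<^sub>m k) $$ (i, j)\<close>, this sum
    carries the terms \<open>g k\<close> and the preceding one the terms \<open>g (Suc k)\<close>,
    as \<open>sum_binomial_Suc\<close> requires.\<close>
  also have "c * ?T j = (\<Sum>k\<le>m. of_nat (m choose k) * (c ^ (Suc m - k) * (M ^\<^sub>m k) $$ (i, j)))"
    using Suc by (auto simp: sum_distrib_left Suc_diff_le algebra_simps intro!: sum.cong)
  finally show ?case
    unfolding sum_binomial_Suc by (simp add: sum.distrib algebra_simps del: pow_mat.simps)
qed

lemma mat_exp_index_sums:
  fixes M :: "complex mat"
  assumes "M \<in> carrier_mat n n" "i < n" "j < n"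
  shows "(\<lambda>m. (M ^\<^sub>m m) $$ (i, j) / fact m) sums (mat_exp M $$ (i, j))"
  using summable_sums[OF summable_mat_exp[OF assms]] assms by (simp add: mat_exp_def)

lemma mat_exp_carrier [simp]: "M \<in> carrier_mat n n \<Longrightarrow> mat_exp M \<in> carrier_mat n n"
  by (simp add: mat_exp_def)

text \<open>Each entry is the Cauchy product of the series for \<open>M\<close> and for
  \<open>exp c\<close>: dividing the binomial coefficient by \<open>fact m\<close> leaves
  \<open>1 / (fact k * fact (m - k))\<close>.\<close>

lemma mat_exp_add_scalar:
  fixes M :: "complex mat"
  assumes M: "M \<in> carrier_mat n n"
  shows "mat_exp (M + c \<cdot>\<^sub>m 1\<^sub>m n) = exp c \<cdot>\<^sub>m mat_exp M"
proof (rule eq_matI)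
  fix i j
  assume "i < dim_row (exp c \<cdot>\<^sub>m mat_exp M)" "j < dim_col (exp c \<cdot>\<^sub>m mat_exp M)"
  with M have ij: "i < n" "j < n" by (auto simp: mat_exp_def)
  let ?a = "\<lambda>k. (M ^\<^sub>m k) $$ (i, j) / fact k" and ?b = "\<lambda>k. c ^ k / fact k"
  have b: "?b sums exp c"
    using exp_converges[of c] by (simp add: scaleR_conv_of_real divide_inverse mult.commute)
  \<comment> \<open>Mertens-type multiplication of the two series is applied with absolute
    convergence of both factors.\<close>
  have "summable (\<lambda>k. norm (?b k))"
    using summable_norm_exp[of c] by (simp add: divide_inverse mult.commute norm_mult norm_inverse)
  from Cauchy_product_sums[OF summable_norm_mat_exp[OF M ij] this]
  have "(\<lambda>m. \<Sum>k\<le>m. ?a k * ?b (m - k)) sums (mat_exp M $$ (i, j) * exp c)"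
    using mat_exp_index_sums[OF M ij] b by (simp add: sums_iff)
  moreover have "(\<Sum>k\<le>m. ?a k * ?b (m - k)) = ((M + c \<cdot>\<^sub>m 1\<^sub>m n) ^\<^sub>m m) $$ (i, j) / fact m" for m
    unfolding pow_add_scalar_mat_index[OF M ij] sum_divide_distrib
    by (intro sum.cong) (auto simp: binomial_fact)
  ultimately have "mat_exp (M + c \<cdot>\<^sub>m 1\<^sub>m n) $$ (i, j) = mat_exp M $$ (i, j) * exp c"
    using mat_exp_index_sums[of "M + c \<cdot>\<^sub>m 1\<^sub>m n" n i j] M ij by (auto simp: sums_iff)
  with M ij show "mat_exp (M + c \<cdot>\<^sub>m 1\<^sub>m n) $$ (i, j) = (exp c \<cdot>\<^sub>m mat_exp M) $$ (i, j)"
    by (simp add: mat_exp_def)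
qed (use M in \<open>auto simp: mat_exp_def\<close>)

text \<open>A Hadamard change of basis on the two copies turns the block matrix into the block
  diagonal matrix of \<open>S\<close> and \<open>D\<close>. Undoing it on the powers gives half the
  sum and half the difference; the induction checks this directly, without the change of
  basis.\<close>

lemma pow_four_block_mat_scalar:
  fixes M :: "complex mat" and c :: complex
  assumes M: "M \<in> carrier_mat n n"
  defines "S \<equiv> M + c \<cdot>\<^sub>m 1\<^sub>m n" and "D \<equiv> M + (- c) \<cdot>\<^sub>m 1\<^sub>m n"
  shows "four_block_mat M (c \<cdot>\<^sub>m 1\<^sub>m n) (c \<cdot>\<^sub>m 1\<^sub>m n) M ^\<^sub>m m
       = (let P = (1 / 2) \<cdot>\<^sub>m (S ^\<^sub>m m + D ^\<^sub>m m); Q = (1 / 2) \<cdot>\<^sub>m (S ^\<^sub>m m - D ^\<^sub>m m)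
          in four_block_mat P Q Q P)"
proof (induction m)
  case 0
  have "(1 / 2) \<cdot>\<^sub>m (1\<^sub>m n + 1\<^sub>m n) = (1\<^sub>m n :: complex mat)" "(1 / 2) \<cdot>\<^sub>m (1\<^sub>m n - 1\<^sub>m n) = (0\<^sub>m n n :: complex mat)"
    by (auto intro!: eq_matI)
  then show ?case using M by (auto simp: S_def D_def Let_def)
next
  case (Suc m)
  define X where "X = S ^\<^sub>m m"
  define Y where "Y = D ^\<^sub>m m"
  have c: "S \<in> carrier_mat n n" "D \<in> carrier_mat n n" "X \<in> carrier_mat n n" "Y \<in> carrier_mat n n"
    using M by (auto simp: S_def D_def X_def Y_def)
  have XS: "X * S = X * M + c \<cdot>\<^sub>m X" and YD: "Y * D = Y * M - c \<cdot>\<^sub>m Y"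
    using M c unfolding S_def D_def
    by (auto simp: mult_add_distrib_mat[of _ n n _ n] mult_smult_distrib[of _ n n _ n] intro!: eq_matI)
  have "(X - Y) * M = X * M - Y * M"
    using M c by (intro minus_mult_distrib_mat) auto
  then have "(1 / 2) \<cdot>\<^sub>m (X - Y) * M = (1 / 2) \<cdot>\<^sub>m (X * M - Y * M)"
    using M c by (simp add: mult_smult_assoc_mat[OF minus_carrier_mat])
  with M c have p: "(1 / 2) \<cdot>\<^sub>m (X + Y) * M = (1 / 2) \<cdot>\<^sub>m (X * M + Y * M)"
    "(1 / 2) \<cdot>\<^sub>m (X - Y) * M = (1 / 2) \<cdot>\<^sub>m (X * M - Y * M)"
    "(1 / 2) \<cdot>\<^sub>m (X + Y) * (c \<cdot>\<^sub>m 1\<^sub>m n) = (c / 2) \<cdot>\<^sub>m (X + Y)"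
    "(1 / 2) \<cdot>\<^sub>m (X - Y) * (c \<cdot>\<^sub>m 1\<^sub>m n) = (c / 2) \<cdot>\<^sub>m (X - Y)"
    by (simp_all add: mult_smult_distrib[of _ n n _ n] mult_smult_assoc_mat[of _ n n _ n]
        add_mult_distrib_mat[of _ n n _ _ n])
      (auto intro!: eq_matI)
  \<comment> \<open>These are the four blocks of the product, row by row; the terms with
    \<open>c\<close> turn \<open>M\<close> into \<open>S\<close> behind \<open>X\<close> and into
    \<open>D\<close> behind \<open>Y\<close>.\<close>
  have e1: "(1 / 2) \<cdot>\<^sub>m (X + Y) * M + (1 / 2) \<cdot>\<^sub>m (X - Y) * (c \<cdot>\<^sub>m 1\<^sub>m n) = (1 / 2) \<cdot>\<^sub>m (X * S + Y * D)"
    and e2: "(1 / 2) \<cdot>\<^sub>m (X + Y) * (c \<cdot>\<^sub>m 1\<^sub>m n) + (1 / 2) \<cdot>\<^sub>m (X - Y) * M = (1 / 2) \<cdot>\<^sub>m (X * S - Y * D)"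
    and e3: "(1 / 2) \<cdot>\<^sub>m (X - Y) * M + (1 / 2) \<cdot>\<^sub>m (X + Y) * (c \<cdot>\<^sub>m 1\<^sub>m n) = (1 / 2) \<cdot>\<^sub>m (X * S - Y * D)"
    and e4: "(1 / 2) \<cdot>\<^sub>m (X - Y) * (c \<cdot>\<^sub>m 1\<^sub>m n) + (1 / 2) \<cdot>\<^sub>m (X + Y) * M = (1 / 2) \<cdot>\<^sub>m (X * S + Y * D)"
    unfolding XS YD p using M c by (auto simp: field_simps intro!: eq_matI)
  show ?case
    using Suc M c minus_carrier_mat[OF c(4), of X]
    by (simp add: Let_def mult_four_block_mat[where ?nr1.0 = n and ?n1.0 = n and ?n2.0 = n and ?nr2.0 = n and ?nc1.0 = n and ?nc2.0 = n] e1 e2 e3 e4 flip: X_def Y_def)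
qed

text \<open>Summing the powers gives half the sum and half the difference of
  \<open>mat_exp S\<close> and \<open>mat_exp D\<close>. These are \<open>exp c\<close> and
  \<open>exp (- c)\<close> times \<open>mat_exp M\<close>, whence cosh and sinh.\<close>

lemma mat_exp_four_block_scalar:
  fixes M :: "complex mat"
  assumes M: "M \<in> carrier_mat n n"
  shows "mat_exp (four_block_mat M (c \<cdot>\<^sub>m 1\<^sub>m n) (c \<cdot>\<^sub>m 1\<^sub>m n) M)
       = four_block_mat (cosh c \<cdot>\<^sub>m mat_exp M) (sinh c \<cdot>\<^sub>m mat_exp M)
           (sinh c \<cdot>\<^sub>m mat_exp M) (cosh c \<cdot>\<^sub>m mat_exp M)"
    (is "mat_exp ?B = ?R")
proof (rule eq_matI)
  define S where "S = M + c \<cdot>\<^sub>m 1\<^sub>m n"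
  define D where "D = M + (- c) \<cdot>\<^sub>m 1\<^sub>m n"
  have SD: "S \<in> carrier_mat n n" "D \<in> carrier_mat n n" using M by (auto simp: S_def D_def)
  have B: "?B \<in> carrier_mat (n + n) (n + n)" using M by simp
  note pow = pow_four_block_mat_scalar[OF M, of c, folded S_def D_def]
  \<comment> \<open>The sign \<open>s\<close> treats both kinds of blocks at once: 1 for the
    diagonal ones, - 1 for the others.\<close>
  have sums: "(\<lambda>m. (1 / 2) * ((S ^\<^sub>m m) $$ (i, j) + s * (D ^\<^sub>m m) $$ (i, j)) / fact m)
      sums ((1 / 2) * ((exp c + s * exp (- c)) * mat_exp M $$ (i, j)))"
    if ij: "i < n" "j < n" for i j s
  proof -
    have "mat_exp S $$ (i, j) = exp c * mat_exp M $$ (i, j)"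
      "mat_exp D $$ (i, j) = exp (- c) * mat_exp M $$ (i, j)"
      unfolding S_def D_def mat_exp_add_scalar[OF M] using M ij by (auto simp: mat_exp_def)
    then show ?thesis
      using sums_mult[OF sums_add[OF mat_exp_index_sums[OF SD(1) ij]
          sums_mult[OF mat_exp_index_sums[OF SD(2) ij], of s]], of "1 / 2"]
      by (simp add: field_simps)
  qed
  have ch: "cosh c = (1 / 2) * (exp c + 1 * exp (- c))" "sinh c = (1 / 2) * (exp c + (- 1) * exp (- c))"
    by (simp_all add: cosh_def sinh_def scaleR_conv_of_real)
  fix i j
  assume "i < dim_row ?R" "j < dim_col ?R"
  then have ij: "i < n + n" "j < n + n" using M by (auto simp: mat_exp_def)
  have "(\<lambda>m. (?B ^\<^sub>m m) $$ (i, j) / fact m) sums (?R $$ (i, j))"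
    \<comment> \<open>The indices are reduced to positions inside a block, and the sign is chosen by
      whether that block is diagonal.\<close>
    using sums[of "if i < n then i else i - n" "if j < n then j else j - n"
        "if (i < n) = (j < n) then 1 else - 1"] ij M SD
    unfolding pow Let_def ch
    by (auto simp: mat_exp_def algebra_simps pow_mat_dim_square[OF SD(1)] pow_mat_dim_square[OF SD(2)]
        split: if_splits simp del: pow_mat_dim)
  with mat_exp_index_sums[OF B ij] show "mat_exp ?B $$ (i, j) = ?R $$ (i, j)"
    by (rule sums_unique2)
qed (use M in \<open>auto simp: mat_exp_def\<close>)

subsection \<open>Inserting a qubit into a circuit\<close>

unbundle bit_operations_syntax

text \<open>A basis state of \<open>Suc N\<close> qubits amounts to the state \<open>b\<close> of
  the qubit at position \<open>p\<close> together with a basis state \<open>x\<close> of the other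
  \<open>N\<close>; this is the number of that pair.\<close>

definition insert_bit :: "nat \<Rightarrow> bool \<Rightarrow> nat \<Rightarrow> nat" where
  "insert_bit p b x = take_bit p x OR of_bool b * 2 ^ p OR push_bit (Suc p) (drop_bit p x)"

definition delete_bit :: "nat \<Rightarrow> nat \<Rightarrow> nat" where
  "delete_bit p x = take_bit p x OR push_bit p (drop_bit (Suc p) x)"

text \<open>The new number of an old qubit \<open>i\<close> after the insertion at position
  \<open>p\<close>.\<close>

definition skip_qubit :: "nat \<Rightarrow> nat \<Rightarrow> nat" where
  "skip_qubit p i = (if i < p then i else Suc i)"

lemma bit_insert_bit:
  "bit (insert_bit p b x) i = (if i < p then bit x i else if i = p then b else bit x (i - 1))"
  by (auto simp: insert_bit_def bit_simps simp del: push_bit_Suc)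

lemma bit_delete_bit: "bit (delete_bit p x) i = (if i < p then bit x i else bit x (Suc i))"
  by (auto simp: delete_bit_def bit_simps simp del: drop_bit_Suc)

lemma bit_insert_bit_skip [simp]: "bit (insert_bit p b x) (skip_qubit p i) = bit x i"
  by (auto simp: bit_insert_bit skip_qubit_def)

lemma bit_insert_bit_same [simp]: "bit (insert_bit p b x) p = b"
  by (simp add: bit_insert_bit)

lemma delete_insert_bit [simp]: "delete_bit p (insert_bit p b x) = x"
  by (rule bit_eqI) (auto simp: bit_insert_bit bit_delete_bit)

lemma insert_delete_bit [simp]: "insert_bit p (bit x p) (delete_bit p x) = x"
  by (rule bit_eqI) (auto simp: bit_insert_bit bit_delete_bit)

lemma insert_bit_eq_iff [simp]: "insert_bit p b x = insert_bit p b' y \<longleftrightarrow> b = b' \<and> x = y"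
proof
  assume *: "insert_bit p b x = insert_bit p b' y"
  have "b = b'"
    using arg_cong[OF *, of "\<lambda>z. bit z p"] by simp
  moreover have "x = y"
    using arg_cong[OF *, of "delete_bit p"] by simp
  ultimately show "b = b' \<and> x = y" ..
qed simp

text \<open>Turns range conditions on basis states into statements about bits, where insertion is
  easy to compute.\<close>

lemma nat_less_exp_iff_bit: "(x :: nat) < 2 ^ N \<longleftrightarrow> (\<forall>i\<ge>N. \<not> bit x i)"
proof -
  have "x < 2 ^ N \<longleftrightarrow> take_bit N x = x"
    by (rule take_bit_nat_eq_self_iff[symmetric])
  also have "\<dots> \<longleftrightarrow> (\<forall>i. bit (take_bit N x) i = bit x i)"
    by (metis bit_eqI)
  also have "\<dots> \<longleftrightarrow> (\<forall>i\<ge>N. \<not> bit x i)"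
    unfolding bit_take_bit_iff using not_less by blast
  finally show ?thesis .
qed

lemma all_ge_Suc_iff: "(\<forall>i\<ge>Suc N. P i) \<longleftrightarrow> (\<forall>i\<ge>N. P (Suc i))"
  by (metis Suc_le_D Suc_le_mono)

text \<open>The bound is written \<open>2 * 2 ^ N\<close> because simplification rewrites
  \<open>2 ^ Suc N\<close> to it.\<close>

lemma insert_bit_less [simp]:
  assumes "p \<le> N"
  shows "insert_bit p b x < 2 * 2 ^ N \<longleftrightarrow> x < 2 ^ N"
proof -
  have "(\<forall>i\<ge>Suc N. \<not> bit (insert_bit p b x) i) \<longleftrightarrow> (\<forall>i\<ge>N. \<not> bit (insert_bit p b x) (Suc i))"
    by (rule all_ge_Suc_iff)
  also have "\<dots> \<longleftrightarrow> (\<forall>i\<ge>N. \<not> bit x i)"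
    using assms by (simp add: bit_insert_bit del: bit_Suc cong: conj_cong imp_cong)
  finally show ?thesis
    unfolding power_Suc[symmetric] nat_less_exp_iff_bit .
qed

lemma insert_bit_cases:
  assumes "p \<le> N" "z < 2 * 2 ^ N"
  obtains b x where "x < 2 ^ N" "z = insert_bit p b x"
  using that[of "delete_bit p z" "bit z p"] assms insert_bit_less[of p N "bit z p" "delete_bit p z"]
  by simp

text \<open>Splits the quantifier over all qubits in \<open>gate_mat\<close> into the inserted qubit
  and the old ones.\<close>

lemma less_Suc_iff_skip_qubit:
  assumes "p \<le> N"
  shows "i < Suc N \<longleftrightarrow> i = p \<or> (\<exists>j<N. i = skip_qubit p j)"
proof
  assume i: "i < Suc N"
  consider "i = p" | "i < p" | "p < i" by linarith
  then show "i = p \<or> (\<exists>j<N. i = skip_qubit p j)"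
  proof cases
    case 2
    then show ?thesis using assms by (intro disjI2 exI[of _ i]) (simp add: skip_qubit_def)
  next
    case 3
    then show ?thesis using i by (intro disjI2 exI[of _ "i - 1"]) (auto simp: skip_qubit_def)
  qed simp
next
  assume "i = p \<or> (\<exists>j<N. i = skip_qubit p j)"
  then show "i < Suc N" using assms by (auto simp: skip_qubit_def)
qed

lemma skip_qubit_eq_iff [simp]: "skip_qubit p i = skip_qubit p j \<longleftrightarrow> i = j"
  by (auto simp: skip_qubit_def split: if_splits)

lemma skip_qubit_neq [simp]: "skip_qubit p i \<noteq> p" "p \<noteq> skip_qubit p i"
  by (auto simp: skip_qubit_def)

lemma sum_insert_bit:
  assumes "p \<le> N"
  shows "(\<Sum>y<2 * 2 ^ N. g y) = (\<Sum>x<2 ^ N. g (insert_bit p False x) + g (insert_bit p True x))"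
proof -
  have "(\<Sum>y<2 * 2 ^ N. g y) = (\<Sum>(b, x)\<in>UNIV \<times> {..<2 ^ N}. g (insert_bit p b x))"
  proof (rule sum.reindex_bij_witness
      [where i = "\<lambda>(b, x). insert_bit p b x" and j = "\<lambda>y. (bit y p, delete_bit p y)"])
    fix y :: nat
    assume "y \<in> {..<2 * 2 ^ N}"
    then have "y < 2 * 2 ^ N" by simp
    with assms obtain b x where "x < 2 ^ N" "y = insert_bit p b x"
      by (rule insert_bit_cases)
    then show "(bit y p, delete_bit p y) \<in> UNIV \<times> {..<2 ^ N}" by simp
  qed (use assms in auto)
  also have "\<dots> = (\<Sum>x<2 ^ N. g (insert_bit p False x) + g (insert_bit p True x))"
    unfolding sum.cartesian_product[symmetric] by (simp add: UNIV_bool sum.distrib)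
  finally show ?thesis .
qed

section \<open>Gates acting on the two halves of a state\<close>

text \<open>The state whose component with qubit \<open>p\<close> in state 0 is \<open>v\<close> and
  with qubit \<open>p\<close> in state 1 is \<open>w\<close>, that is, the tensor sum of 0 with
  \<open>v\<close> and 1 with \<open>w\<close>.\<close>

definition join_vec :: "nat \<Rightarrow> nat \<Rightarrow> complex vec \<Rightarrow> complex vec \<Rightarrow> complex vec" where
  "join_vec N p v w = vec (2 * 2 ^ N) (\<lambda>x. (if bit x p then w else v) $ delete_bit p x)"

lemma join_vec_index [simp]:
  assumes "p \<le> N" "x < 2 ^ N"
  shows "join_vec N p v w $ insert_bit p b x = (if b then w else v) $ x"
  using assms by (simp add: join_vec_def)

lemma dim_join_vec [simp]: "dim_vec (join_vec N p v w) = 2 * 2 ^ N"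
  by (simp add: join_vec_def)

lemma join_vecI:
  assumes "p \<le> N" "dim_vec u = 2 * 2 ^ N"
    and "\<And>x. x < 2 ^ N \<Longrightarrow> u $ insert_bit p False x = v $ x"
    and "\<And>x. x < 2 ^ N \<Longrightarrow> u $ insert_bit p True x = w $ x"
  shows "u = join_vec N p v w"
proof (rule eq_vecI)
  fix z
  assume "z < dim_vec (join_vec N p v w)"
  then have "z < 2 * 2 ^ N" by simp
  with assms(1) obtain b x where "x < 2 ^ N" "z = insert_bit p b x"
    by (rule insert_bit_cases)
  then show "u $ z = join_vec N p v w $ z"
    using assms by (cases b) auto
qed (use assms in auto)

lemma mult_mat_join_vec_index:
  assumes "p \<le> N" "G \<in> carrier_mat (2 * 2 ^ N) (2 * 2 ^ N)" "z < 2 * 2 ^ N"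
  shows "(G *\<^sub>v join_vec N p v w) $ z
       = (\<Sum>y<2 ^ N. G $$ (z, insert_bit p False y) * v $ y + G $$ (z, insert_bit p True y) * w $ y)"
proof -
  have "(G *\<^sub>v join_vec N p v w) $ z = (\<Sum>y<2 * 2 ^ N. G $$ (z, y) * join_vec N p v w $ y)"
    using assms by (simp add: scalar_prod_def atLeast0LessThan)
  then show ?thesis using assms by (simp add: sum_insert_bit)
qed

definition lift_gate :: "nat \<Rightarrow> gate \<Rightarrow> gate" where
  "lift_gate p = (\<lambda>(qs, U). (map (skip_qubit p) qs, U))"

lemma valid_lift_gate:
  assumes "p \<le> N" "valid_gate N g"
  shows "valid_gate (Suc N) (lift_gate p g)"
  using assms by (force simp: valid_gate_def lift_gate_def distinct_map inj_on_def skip_qubit_def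
      split: prod.splits)

lemma gate_mat_carrier [simp]: "gate_mat N g \<in> carrier_mat (2 ^ N) (2 ^ N)"
  by (simp add: gate_mat_def split: prod.split)

lemma dim_gate_mat [simp]: "dim_row (gate_mat N g) = 2 ^ N" "dim_col (gate_mat N g) = 2 ^ N"
  by (simp_all add: gate_mat_def split: prod.split)

lemma circuit_mat_carrier [simp]: "circuit_mat N gs \<in> carrier_mat (2 ^ N) (2 ^ N)"
  by (induction gs) auto

text \<open>A lifted gate never lists qubit \<open>p\<close>, so it preserves that bit and reads the
  same sub-index as before: it is the old gate tensored with the identity.\<close>

lemma gate_mat_lift_index:
  assumes "p \<le> N" "x < 2 ^ N" "y < 2 ^ N"
  shows "gate_mat (Suc N) (lift_gate p g) $$ (insert_bit p b x, insert_bit p b' y)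
       = (if b = b' then gate_mat N g $$ (x, y) else 0)"
proof -
  obtain qs U where g: "g = (qs, U)" by (cases g)
  have "sub_index (map (skip_qubit p) qs) (insert_bit p d z) = sub_index qs z" for d z
    unfolding sub_index_def by (intro sum.cong) auto
  moreover have "(\<forall>i<Suc N. i \<notin> set (map (skip_qubit p) qs) \<longrightarrow>
        bit (insert_bit p b x) i = bit (insert_bit p b' y) i)
      \<longleftrightarrow> b = b' \<and> (\<forall>i<N. i \<notin> set qs \<longrightarrow> bit x i = bit y i)"
    using assms(1) by (auto simp: less_Suc_iff_skip_qubit image_iff)
  ultimately show ?thesis
    using assms by (auto simp: g gate_mat_def lift_gate_def)
qed

text \<open>The complementary case: a gate on qubit \<open>p\<close> alone is \<open>R\<close>
  tensored with the identity on the old qubits.\<close>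

lemma gate_mat_single_index:
  assumes "p \<le> N" "x < 2 ^ N" "y < 2 ^ N"
  shows "gate_mat (Suc N) ([p], R) $$ (insert_bit p b x, insert_bit p b' y)
       = (if x = y then R $$ (of_bool b, of_bool b') else 0)"
proof -
  have "(\<forall>i<Suc N. i \<notin> set [p] \<longrightarrow> bit (insert_bit p b x) i = bit (insert_bit p b' y) i)
      \<longleftrightarrow> (\<forall>i<N. bit x i = bit y i)"
    using assms(1) by (auto simp: less_Suc_iff_skip_qubit)
  also have "\<dots> \<longleftrightarrow> x = y"
  proof
    assume "\<forall>i<N. bit x i = bit y i"
    then show "x = y"
      using assms(2,3) unfolding nat_less_exp_iff_bit by (intro bit_eqI) (metis not_less)
  qed simp
  finally show ?thesis
    using assms by (simp add: gate_mat_def sub_index_def)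
qed

lemma gate_mat_lift_join_vec:
  assumes "p \<le> N" "v \<in> carrier_vec (2 ^ N)" "w \<in> carrier_vec (2 ^ N)"
  shows "gate_mat (Suc N) (lift_gate p g) *\<^sub>v join_vec N p v w
       = join_vec N p (gate_mat N g *\<^sub>v v) (gate_mat N g *\<^sub>v w)"
proof (rule join_vecI)
  let ?G = "gate_mat (Suc N) (lift_gate p g)"
  have G: "?G \<in> carrier_mat (2 * 2 ^ N) (2 * 2 ^ N)"
    using gate_mat_carrier[of "Suc N" "lift_gate p g"] by simp
  then show "dim_vec (?G *\<^sub>v join_vec N p v w) = 2 * 2 ^ N" by simp
  fix x :: nat
  assume x: "x < 2 ^ N"
  show "(?G *\<^sub>v join_vec N p v w) $ insert_bit p False x = (gate_mat N g *\<^sub>v v) $ x"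
    "(?G *\<^sub>v join_vec N p v w) $ insert_bit p True x = (gate_mat N g *\<^sub>v w) $ x"
    using assms G x
    by (simp_all add: mult_mat_join_vec_index gate_mat_lift_index del: index_mult_mat_vec)
      (simp_all add: scalar_prod_def atLeast0LessThan)
qed fact

text \<open>The lifted circuit runs the old one on both halves at once, so its gate count is
  unchanged.\<close>

lemma circuit_mat_lift_join_vec:
  assumes "p \<le> N" "v \<in> carrier_vec (2 ^ N)" "w \<in> carrier_vec (2 ^ N)"
  shows "circuit_mat (Suc N) (map (lift_gate p) gs) *\<^sub>v join_vec N p v w
       = join_vec N p (circuit_mat N gs *\<^sub>v v) (circuit_mat N gs *\<^sub>v w)"
  using assms(2,3)
proof (induction gs arbitrary: v w)
  case Nil
  have "join_vec N p v w \<in> carrier_vec (2 * 2 ^ N)" by (simp add: carrier_vecI)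
  with Nil show ?case by simp
next
  case (Cons g gs)
  have "join_vec N p v w \<in> carrier_vec (2 ^ Suc N)" by (simp add: carrier_vecI)
  then have "circuit_mat (Suc N) (map (lift_gate p) (g # gs)) *\<^sub>v join_vec N p v w
      = circuit_mat (Suc N) (map (lift_gate p) gs) *\<^sub>v
          (gate_mat (Suc N) (lift_gate p g) *\<^sub>v join_vec N p v w)"
    by (simp add: assoc_mult_mat_vec[OF circuit_mat_carrier gate_mat_carrier] del: power_Suc)
  also have "\<dots> = join_vec N p (circuit_mat N gs *\<^sub>v (gate_mat N g *\<^sub>v v))
      (circuit_mat N gs *\<^sub>v (gate_mat N g *\<^sub>v w))"
    using Cons assms(1) mult_mat_vec_carrier[OF gate_mat_carrier]
    by (simp add: gate_mat_lift_join_vec)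
  finally show ?case
    using Cons.prems by (simp add: assoc_mult_mat_vec[OF circuit_mat_carrier gate_mat_carrier])
qed

lemma gate_mat_single_join_vec:
  assumes "p \<le> N" "v \<in> carrier_vec (2 ^ N)" "w \<in> carrier_vec (2 ^ N)"
  shows "gate_mat (Suc N) ([p], R) *\<^sub>v join_vec N p v w
       = join_vec N p (R $$ (0, 0) \<cdot>\<^sub>v v + R $$ (0, 1) \<cdot>\<^sub>v w) (R $$ (1, 0) \<cdot>\<^sub>v v + R $$ (1, 1) \<cdot>\<^sub>v w)"
proof (rule join_vecI)
  let ?G = "gate_mat (Suc N) ([p], R)"
  have G: "?G \<in> carrier_mat (2 * 2 ^ N) (2 * 2 ^ N)"
    using gate_mat_carrier[of "Suc N" "([p], R)"] by simp
  then show "dim_vec (?G *\<^sub>v join_vec N p v w) = 2 * 2 ^ N" by simp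
  fix x :: nat
  assume x: "x < 2 ^ N"
  show "(?G *\<^sub>v join_vec N p v w) $ insert_bit p False x = (R $$ (0, 0) \<cdot>\<^sub>v v + R $$ (0, 1) \<cdot>\<^sub>v w) $ x"
    "(?G *\<^sub>v join_vec N p v w) $ insert_bit p True x = (R $$ (1, 0) \<cdot>\<^sub>v v + R $$ (1, 1) \<cdot>\<^sub>v w) $ x"
    using assms G x
    by (simp_all add: mult_mat_join_vec_index gate_mat_single_index sum.distrib if_distrib
        if_distribR cong: if_cong del: index_mult_mat_vec)
qed fact

section \<open>The encoding of the doubled vertex set\<close>

text \<open>For old codes below \<open>2 ^ q\<close>, adding \<open>2 ^ q\<close> sets the new
  qubit, which is placed directly above the old register and below the ancillas.\<close>

definition double_encoding :: "nat \<Rightarrow> nat \<Rightarrow> (nat \<Rightarrow> nat) \<Rightarrow> nat \<Rightarrow> nat" where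
  "double_encoding q n f j = (if j < n then f j else f (j - n) + 2 ^ q)"

lemma is_encoding_double:
  assumes "is_encoding n q f"
  shows "is_encoding (n + n) (Suc q) (double_encoding q n f)"
proof -
  have f: "f j < 2 ^ q" if "j < n" for j
    using assms that by (auto simp: is_encoding_def)
  have inj: "i = j" if "f i = f j" "i < n" "j < n" for i j
    using assms that by (auto simp: is_encoding_def inj_on_def)
  have "inj_on (double_encoding q n f) {..<n + n}"
  proof (rule inj_onI)
    fix i j
    assume *: "i \<in> {..<n + n}" "j \<in> {..<n + n}" "double_encoding q n f i = double_encoding q n f j"
    consider "i < n" "j < n" | "i < n" "\<not> j < n" | "\<not> i < n" "j < n" | "\<not> i < n" "\<not> j < n"
      by blast
    then show "i = j"
    proof cases
      case 4
      have "i - n = j - n"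
        by (rule inj) (use * 4 in \<open>auto simp: double_encoding_def\<close>)
      with 4 show ?thesis by linarith
    qed (use * f[of i] f[of j] inj[of i j] in \<open>auto simp: double_encoding_def\<close>)
  qed
  moreover have "double_encoding q n f j < 2 ^ Suc q" if "j < n + n" for j
    using f[of j] f[of "j - n"] that by (auto simp: double_encoding_def)
  \<comment> \<open>Parity excludes \<open>m = 0\<close>; otherwise \<open>n\<close> is the power of
    two with exponent \<open>m - 1\<close>, which forces \<open>q = m - 1\<close>.\<close>
  moreover have "Suc q = m" if "n + n = 2 ^ m" for m
    using that assms by (cases m) (auto simp: is_encoding_def simp flip: mult_2)
  ultimately show ?thesis unfolding is_encoding_def by blast
qed

text \<open>Nothing lies at position \<open>q\<close> or above, so no bit moves and the disjunction
  is a sum without carries.\<close>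

lemma insert_bit_small:
  assumes "x < 2 ^ q"
  shows "insert_bit q b x = x + of_bool b * 2 ^ q"
proof -
  have "\<not> bit x q"
    using assms by (simp add: nat_less_exp_iff_bit)
  then have "x AND of_bool b * 2 ^ q = 0"
    by (intro bit_eqI) (auto simp: bit_simps)
  from disjunctive_add_eq_or[OF this] show ?thesis
    using assms by (simp add: insert_bit_def take_bit_nat_eq_self drop_bit_eq_div)
qed

text \<open>Codes have no bits at or above \<open>q\<close>, so inserting the new qubit there yields
  \<open>double_encoding\<close>; the sum over vertices splits at \<open>n\<close> into the two
  copies.\<close>

lemma encode_double:
  assumes "is_encoding n q f" "q \<le> N" "v \<in> carrier_vec n" "w \<in> carrier_vec n"
  shows "encode (Suc N) (double_encoding q n f) (v @\<^sub>v w) = join_vec N q (encode N f v) (encode N f w)"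
proof -
  have f: "f j < 2 ^ q" if "j < n" for j
    using assms that by (auto simp: is_encoding_def)
  have e: "(\<Sum>j<n + n. g j) = (\<Sum>j<n. g j + g (n + j))" for g :: "nat \<Rightarrow> complex"
    using sum.atLeastLessThan_concat[of 0 n "n + n" g] sum.shift_bounds_nat_ivl[of g 0 n n]
    by (simp add: sum.distrib lessThan_atLeast0 add.commute)
  have "encode (Suc N) (double_encoding q n f) (v @\<^sub>v w) $ insert_bit q b x
      = (if b then encode N f w else encode N f v) $ x" if "x < 2 ^ N" for b x
  proof -
    have "encode (Suc N) (double_encoding q n f) (v @\<^sub>v w) $ insert_bit q b x
      = (\<Sum>j<n + n. if double_encoding q n f j = insert_bit q b x then (v @\<^sub>v w) $ j else 0)"
      using that assms by (simp add: encode_def)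
    also have "\<dots> = (\<Sum>j<n. (if insert_bit q False (f j) = insert_bit q b x then v $ j else 0)
        + (if insert_bit q True (f j) = insert_bit q b x then w $ j else 0))"
      unfolding e using f assms
      by (intro sum.cong) (auto simp: double_encoding_def insert_bit_small[of "f _"])
    also have "\<dots> = (if b then encode N f w else encode N f v) $ x"
      using that assms by (auto simp: encode_def intro!: sum.cong)
    finally show ?thesis .
  qed
  then show ?thesis using assms by (intro join_vecI) (auto simp: encode_def)
qed

subsection \<open>The quantum walk on the doubled graph\<close>

lemma encode_carrier [simp]: "encode N f \<psi> \<in> carrier_vec (2 ^ N)"
  by (simp add: encode_def)

text \<open>This is exp(c X) in closed form, since X squares to the identity.\<close>

definition pauli_x_exp :: "complex \<Rightarrow> complex mat" where
  "pauli_x_exp c = mat 2 2 (\<lambda>(i, j). if i = j then cosh c else sinh c)"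

text \<open>For imaginary \<open>c\<close>, \<open>cosh c\<close> is real and \<open>sinh c\<close>
  imaginary, so the adjoint belongs to \<open>- c\<close>; the products reduce to the hyperbolic
  Pythagorean identity.\<close>

lemma unitary_pauli_x_exp:
  assumes "Re c = 0"
  shows "unitary_mat 2 (pauli_x_exp c)"
proof -
  define \<theta> where "\<theta> = Im c"
  have c: "c = \<i> * of_real \<theta>"
    using assms by (simp add: complex_eq_iff \<theta>_def)
  have e: "exp c = cis \<theta>" "exp (- c) = cis (- \<theta>)"
    by (simp_all add: c cis_conv_exp)
  have cnj: "cnj (cosh c) = cosh c" "cnj (sinh c) = - sinh c"
    by (simp_all add: cosh_def sinh_def e cis_cnj algebra_simps)
  have adj: "mat_adjoint (pauli_x_exp c) = mat 2 2 (\<lambda>(i, j). if i = j then cosh c else - sinh c)"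
    by (rule eq_matI) (auto simp: mat_adjoint_def mat_of_rows_def pauli_x_exp_def cnj)
  have "cosh c * cosh c - sinh c * sinh c = 1"
    using hyperbolic_pythagoras[of c] by (simp add: power2_eq_square)
  moreover have "(\<Sum>i\<in>{0..<2}. g i) = g 0 + g 1" for g :: "nat \<Rightarrow> complex"
    by (simp add: numeral_2_eq_2)
  ultimately have "mat_adjoint (pauli_x_exp c) * pauli_x_exp c = 1\<^sub>m 2"
    "pauli_x_exp c * mat_adjoint (pauli_x_exp c) = 1\<^sub>m 2"
    unfolding adj
    by (auto simp: pauli_x_exp_def scalar_prod_def dest!: less_2_cases intro!: eq_matI)
  then show ?thesis
    by (simp add: unitary_mat_def pauli_x_exp_def)
qed

text \<open>Ensures that both halves are still encoded states after the new gate, so that the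
  guarantee for the old circuit applies to them.\<close>

lemma encode_lincomb:
  assumes "v \<in> carrier_vec n" "w \<in> carrier_vec n"
  shows "encode N f (x \<cdot>\<^sub>v v + y \<cdot>\<^sub>v w) = x \<cdot>\<^sub>v encode N f v + y \<cdot>\<^sub>v encode N f w"
proof (rule eq_vecI)
  fix z
  assume "z < dim_vec (x \<cdot>\<^sub>v encode N f v + y \<cdot>\<^sub>v encode N f w)"
  then have z: "z < 2 ^ N" by (simp add: encode_def)
  have "encode N f (x \<cdot>\<^sub>v v + y \<cdot>\<^sub>v w) $ z = (\<Sum>j<n. if f j = z then x * v $ j + y * w $ j else 0)"
    using assms z by (auto simp: encode_def intro!: sum.cong)
  also have "\<dots> = (\<Sum>j<n. x * (if f j = z then v $ j else 0) + y * (if f j = z then w $ j else 0))"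
    by (intro sum.cong) auto
  also have "\<dots> = (x \<cdot>\<^sub>v encode N f v + y \<cdot>\<^sub>v encode N f w) $ z"
    using assms z by (simp add: encode_def sum.distrib sum_distrib_left)
  finally show "encode N f (x \<cdot>\<^sub>v v + y \<cdot>\<^sub>v w) $ z = (x \<cdot>\<^sub>v encode N f v + y \<cdot>\<^sub>v encode N f w) $ z" .
qed (simp add: encode_def)

text \<open>The right-hand side mixes the halves first and applies \<open>U\<close> afterwards,
  which is the order of the circuit.\<close>

lemma four_block_mult_append_vec:
  fixes U :: "complex mat"
  assumes "U \<in> carrier_mat n n" "v \<in> carrier_vec n" "w \<in> carrier_vec n"
  shows "four_block_mat (x \<cdot>\<^sub>m U) (y \<cdot>\<^sub>m U) (y \<cdot>\<^sub>m U) (x \<cdot>\<^sub>m U) *\<^sub>v (v @\<^sub>v w)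
       = (U *\<^sub>v (x \<cdot>\<^sub>v v + y \<cdot>\<^sub>v w)) @\<^sub>v (U *\<^sub>v (y \<cdot>\<^sub>v v + x \<cdot>\<^sub>v w))"
proof -
  have "(a \<cdot>\<^sub>m U) *\<^sub>v u = a \<cdot>\<^sub>v (U *\<^sub>v u)" if "u \<in> carrier_vec n" for a u
    using assms that by (intro eq_vecI) auto
  then have "(a \<cdot>\<^sub>m U) *\<^sub>v v + (b \<cdot>\<^sub>m U) *\<^sub>v w = U *\<^sub>v (a \<cdot>\<^sub>v v + b \<cdot>\<^sub>v w)" for a b
    using assms by (simp add: mult_add_distrib_mat_vec[of U n n] mult_mat_vec[of U n n])
  with assms show ?thesis
    by (subst four_block_mat_mult_vec[of _ n n _ n _ n]) auto
qed

text \<open>The new gate mixes the two halves with the coefficients \<open>cosh c\<close> and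
  \<open>sinh c\<close>; the lifted circuit then applies \<open>U\<close> to each. Imaginary
  \<open>c\<close> makes the new gate valid.\<close>

lemma implements_double:
  assumes enc: "is_encoding n q f"
    and impl: "implements q a gs f n U"
    and U: "U \<in> carrier_mat n n"
    and c: "Re c = 0"
  shows "implements (Suc q) a (([q], pauli_x_exp c) # map (lift_gate q) gs) (double_encoding q n f)
    (n + n) (four_block_mat (cosh c \<cdot>\<^sub>m U) (sinh c \<cdot>\<^sub>m U) (sinh c \<cdot>\<^sub>m U) (cosh c \<cdot>\<^sub>m U))"
proof -
  let ?N = "q + a"
  let ?R = "pauli_x_exp c"
  let ?f = "double_encoding q n f"
  have "valid_gate (Suc ?N) ([q], ?R)"
    using unitary_pauli_x_exp[OF c] by (simp add: valid_gate_def)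
  moreover have "\<forall>g\<in>set gs. valid_gate (Suc ?N) (lift_gate q g)"
    using impl by (auto simp: implements_def intro: valid_lift_gate)
  moreover have "circuit_mat (Suc ?N) (([q], ?R) # map (lift_gate q) gs) *\<^sub>v encode (Suc ?N) ?f \<psi>
      = encode (Suc ?N) ?f
          (four_block_mat (cosh c \<cdot>\<^sub>m U) (sinh c \<cdot>\<^sub>m U) (sinh c \<cdot>\<^sub>m U) (cosh c \<cdot>\<^sub>m U) *\<^sub>v \<psi>)"
    if "\<psi> \<in> carrier_vec (n + n)" for \<psi>
  proof -
    define v where "v = vec_first \<psi> n"
    define w where "w = vec_last \<psi> n"
    have vw: "v \<in> carrier_vec n" "w \<in> carrier_vec n" and \<psi>: "\<psi> = v @\<^sub>v w"
      using that by (simp_all add: v_def w_def)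
    let ?E = "encode ?N f"
    let ?v = "cosh c \<cdot>\<^sub>v v + sinh c \<cdot>\<^sub>v w" and ?w = "sinh c \<cdot>\<^sub>v v + cosh c \<cdot>\<^sub>v w"
    have vw': "?v \<in> carrier_vec n" "?w \<in> carrier_vec n" using vw by auto
    have run: "circuit_mat ?N gs *\<^sub>v ?E u = ?E (U *\<^sub>v u)" if "u \<in> carrier_vec n" for u
      using impl that by (simp add: implements_def)
    have "circuit_mat (Suc ?N) (([q], ?R) # map (lift_gate q) gs) *\<^sub>v encode (Suc ?N) ?f \<psi>
        = circuit_mat (Suc ?N) (map (lift_gate q) gs) *\<^sub>v
            (gate_mat (Suc ?N) ([q], ?R) *\<^sub>v encode (Suc ?N) ?f \<psi>)"
      by (simp only: circuit_mat.simps
          assoc_mult_mat_vec[OF circuit_mat_carrier gate_mat_carrier encode_carrier])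
    also have "gate_mat (Suc ?N) ([q], ?R) *\<^sub>v encode (Suc ?N) ?f \<psi> = join_vec ?N q (?E ?v) (?E ?w)"
      unfolding \<psi> using vw
      by (simp add: encode_double[OF enc] gate_mat_single_join_vec encode_lincomb)
        (simp add: pauli_x_exp_def)
    also have "circuit_mat (Suc ?N) (map (lift_gate q) gs) *\<^sub>v \<dots>
        = join_vec ?N q (?E (U *\<^sub>v ?v)) (?E (U *\<^sub>v ?w))"
      using vw' by (simp only: circuit_mat_lift_join_vec[OF le_add1 encode_carrier encode_carrier] run)
    also have "\<dots> = encode (Suc ?N) ?f ((U *\<^sub>v ?v) @\<^sub>v (U *\<^sub>v ?w))"
      using U vw' by (intro encode_double[OF enc, symmetric]) auto
    also have "(U *\<^sub>v ?v) @\<^sub>v (U *\<^sub>v ?w)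
        = four_block_mat (cosh c \<cdot>\<^sub>m U) (sinh c \<cdot>\<^sub>m U) (sinh c \<cdot>\<^sub>m U) (cosh c \<cdot>\<^sub>m U) *\<^sub>v \<psi>"
      unfolding \<psi> by (rule four_block_mult_append_vec[OF U vw, symmetric])
    finally show ?thesis .
  qed
  ultimately show ?thesis by (simp add: implements_def del: circuit_mat.simps)
qed

lemma ctqw_four_block:
  fixes \<gamma> t :: real
  assumes A: "A \<in> carrier_mat n n"
  defines "c \<equiv> - \<i> * of_real (t * \<gamma>)"
  shows "ctqw \<gamma> (four_block_mat A (1\<^sub>m n) (1\<^sub>m n) A) t
       = four_block_mat (cosh c \<cdot>\<^sub>m ctqw \<gamma> A t) (sinh c \<cdot>\<^sub>m ctqw \<gamma> A t)
           (sinh c \<cdot>\<^sub>m ctqw \<gamma> A t) (cosh c \<cdot>\<^sub>m ctqw \<gamma> A t)"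
proof -
  let ?M = "(- \<i> * of_real t) \<cdot>\<^sub>m (of_real \<gamma> \<cdot>\<^sub>m A)"
  have M: "?M \<in> carrier_mat n n" using A by simp
  have "(- \<i> * of_real t) \<cdot>\<^sub>m (of_real \<gamma> \<cdot>\<^sub>m four_block_mat A (1\<^sub>m n) (1\<^sub>m n) A)
      = four_block_mat ?M (c \<cdot>\<^sub>m 1\<^sub>m n) (c \<cdot>\<^sub>m 1\<^sub>m n) ?M"
    using A by (intro eq_matI) (auto simp: c_def)
  then show ?thesis
    unfolding ctqw_def by (simp only: mat_exp_four_block_scalar[OF M])
qed

text \<open>At each time the doubled walk needs one gate more than the old one and the same number
  of ancillas, and its encoding is independent of \<open>t\<close>. What remains is to bound the new
  length by a polynomial in the logarithm of the doubled size.\<close>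

theorem mainTheorem2:
  fixes \<gamma> :: real
    and n :: "'k \<Rightarrow> nat"
    and E :: "'k \<Rightarrow> (nat \<times> nat) set"
    and A :: "'k \<Rightarrow> complex mat"
  assumes "\<And>k. undirected_graph (n k) (E k)"
    and "\<And>k. A k = adjacency_mat (n k) (E k)"
    and "ctqw_efficiently_implementable \<gamma> A"
  shows "ctqw_efficiently_implementable \<gamma>
           (\<lambda>k. four_block_mat (A k) (1\<^sub>m (n k)) (1\<^sub>m (n k)) (A k))"
proof -
  have A: "A k \<in> carrier_mat (n k) (n k)" for k
    using assms(2) by (simp add: adjacency_mat_def)
  have dim: "dim_row (A k) = n k" for k using A[of k] by simp
  obtain q enc p where
    enc: "\<And>k. is_encoding (n k) (q k) (enc k)" and
    circ: "\<And>k t. t \<ge> 0 \<Longrightarrow> \<exists>a gs. implements (q k) a gs (enc k) (n k) (ctqw \<gamma> (A k) t) \<and>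
      real (length gs) \<le> poly p (log 2 (real (n k)))"
    using assms(3) unfolding ctqw_efficiently_implementable_def dim by blast
  \<comment> \<open>The summand \<open>p\<^sup>2\<close> covers \<open>n k = 0\<close>, where \<open>log 2 0 = 0\<close> and doubling does not add 1.\<close>
  define p' where "p' = (pcompose p [:-1, 1:])\<^sup>2 + p\<^sup>2 + [:2:]"
  have y: "y \<le> y\<^sup>2 + 1" for y :: real
    using zero_le_power2[of "y - 1 / 2"] by (simp add: power2_eq_square algebra_simps)
  \<comment> \<open>Squares keep the summands of \<open>p'\<close> nonnegative, so neither
    evaluation of \<open>p\<close> can spoil the bound for the other. The constant 2 pays for the
    new gate and for the 1 in \<open>y\<close>.\<close>
  have p': "poly p z + 1 \<le> poly p' z" "poly p (z - 1) + 1 \<le> poly p' z" for z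
  proof -
    have "poly p' z = (poly p (z - 1))\<^sup>2 + (poly p z)\<^sup>2 + 2"
      by (simp add: p'_def poly_pcompose)
    then show "poly p z + 1 \<le> poly p' z" "poly p (z - 1) + 1 \<le> poly p' z"
      using y[of "poly p z"] y[of "poly p (z - 1)"]
        zero_le_power2[of "poly p z"] zero_le_power2[of "poly p (z - 1)"]
      by linarith+
  qed
  show ?thesis
    unfolding ctqw_efficiently_implementable_def
  proof (rule exI[of _ "\<lambda>k. Suc (q k)"], rule exI[of _ "\<lambda>k. double_encoding (q k) (n k) (enc k)"],
      rule exI[of _ p'], intro allI conjI impI)
    fix k and t :: real
    let ?A2 = "four_block_mat (A k) (1\<^sub>m (n k)) (1\<^sub>m (n k)) (A k)"
    have dim2: "dim_row ?A2 = n k + n k" using A[of k] by simp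
    show "is_encoding (dim_row ?A2) (Suc (q k)) (double_encoding (q k) (n k) (enc k))"
      unfolding dim2 by (rule is_encoding_double[OF enc])
    assume "0 \<le> t"
    from circ[OF this, of k] obtain a gs
      where gs: "implements (q k) a gs (enc k) (n k) (ctqw \<gamma> (A k) t)"
        and len: "real (length gs) \<le> poly p (log 2 (real (n k)))" by blast
    let ?c = "- \<i> * of_real (t * \<gamma>)"
    let ?gs = "([q k], pauli_x_exp ?c) # map (lift_gate (q k)) gs"
    have "ctqw \<gamma> (A k) t \<in> carrier_mat (n k) (n k)"
      using A by (simp add: ctqw_def)
    from implements_double[OF enc gs this, of ?c]
    have "implements (Suc (q k)) a ?gs (double_encoding (q k) (n k) (enc k))
        (dim_row ?A2) (ctqw \<gamma> ?A2 t)"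
      unfolding dim2 ctqw_four_block[OF A] by simp
    moreover have "real (length ?gs) \<le> poly p' (log 2 (real (dim_row ?A2)))"
    proof (cases "n k = 0")
      case True
      then show ?thesis
        unfolding dim2 using len p'(1)[of 0] by (simp add: log_def)
    next
      case False
      \<comment> \<open>Doubling raises the logarithm by exactly 1, which the shifted argument
        \<open>z - 1\<close> in \<open>p'\<close> undoes.\<close>
      then have "log 2 (real (n k + n k)) = log 2 (real (n k)) + 1"
        by (simp add: log_mult flip: mult_2)
      then show ?thesis
        unfolding dim2 using len p'(2)[of "log 2 (real (n k)) + 1"] by simp
    qed
    ultimately show "\<exists>a gs. implements (Suc (q k)) a gs (double_encoding (q k) (n k) (enc k))
        (dim_row ?A2) (ctqw \<gamma> ?A2 t) \<and> real (length gs) \<le> poly p' (log 2 (real (dim_row ?A2)))"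
      by blast
  qed
qed

end
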